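(* Let $m\ge 0$ and $s\ge 0$ be integers. Let $q\in\Pi_m$ and let $p\in\Pi$ be a bivariate polynomial for which the origin $O=(0,0)$ is an $s$-fold zero. Then the PDE $$p(D)f=q$$ has a polynomial solution $f\in\Pi_{m+s}$.
   Context: Polynomials have complex coefficients. $\Pi_n=\{\sum_{i+j\le n}a_{ij}x^iy^j\}$ is the space of bivariate polynomials of total degree at most $n$, and $\Pi=\bigcup_{n\ge 0}\Pi_n$. For a polynomial $p$, $p(D)=p\left(\frac{\partial}{\partial x},\frac{\partial}{\partial y}\right)$ is the corresponding constant-coefficient differential operator. For $p=\sum a_{ij}x^iy^j$, the $l$th homogeneous layer of $p$ is $p_{(l)}=\sum_{i+j=l}a_{ij}x^iy^j$. The origin is an $s$-fold zero of $p$ if the lowest nonzero homogeneous layer of $p$ is the $s$th one, i.e. $p_{(l)}=0$ for all $l<s$ and $p_{(s)}\ne 0$ (in particular $p\ne 0$; the case $s=0$ means $p(0,0)\neq 0$). *)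

theory Defs
  imports Complex_Main "HOL-Computational_Algebra.Polynomial"
begin

text \<open>
  A bivariate complex polynomial is an element of \<open>\<complex>[x][y]\<close>: the outer variable is \<open>y\<close>,
  the inner one is \<open>x\<close>. Hence the coefficient of \<open>x\<^sup>i y\<^sup>j\<close> is \<open>coeff (coeff p j) i\<close>.
\<close>

type_synonym bipoly = "complex poly poly"

definition bicoeff :: "bipoly \<Rightarrow> nat \<Rightarrow> nat \<Rightarrow> complex" where
  "bicoeff p i j = coeff (coeff p j) i"

definition bimonom :: "complex \<Rightarrow> nat \<Rightarrow> nat \<Rightarrow> bipoly" where
  "bimonom a i j = monom (monom a i) j"

definition bieval :: "bipoly \<Rightarrow> complex \<Rightarrow> complex \<Rightarrow> complex" where
  "bieval p x y = poly (poly p [:y:]) x"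

definition Pi_deg :: "nat \<Rightarrow> bipoly set" where
  "Pi_deg n = {p. \<forall>i j. bicoeff p i j \<noteq> 0 \<longrightarrow> i + j \<le> n}"

definition layer :: "nat \<Rightarrow> bipoly \<Rightarrow> bipoly" where
  "layer l p = (\<Sum>i\<le>l. bimonom (bicoeff p i (l - i)) i (l - i))"

definition s_fold_zero_at_origin :: "nat \<Rightarrow> bipoly \<Rightarrow> bool" where
  "s_fold_zero_at_origin s p \<longleftrightarrow> (\<forall>l<s. layer l p = 0) \<and> layer s p \<noteq> 0"

definition partial_x :: "bipoly \<Rightarrow> bipoly" where
  "partial_x f = map_poly pderiv f"

definition partial_y :: "bipoly \<Rightarrow> bipoly" where
  "partial_y f = pderiv f"

text \<open>The operator \<open>p(D)\<close>; the sum ranges over all \<open>(i, j)\<close> with a possibly nonzero coefficient.\<close>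

definition diff_op :: "bipoly \<Rightarrow> bipoly \<Rightarrow> bipoly" where
  "diff_op p f = (\<Sum>j\<le>degree p. \<Sum>i\<le>degree (coeff p j).
     smult [:bicoeff p i j:] ((partial_x ^^ i) ((partial_y ^^ j) f)))"

text \<open>The formal operators agree with the analytic partial derivatives of the polynomial function.\<close>

lemma bieval_bimonom: "bieval (bimonom a i j) x y = a * x ^ i * y ^ j"
  by (simp add: bieval_def bimonom_def poly_monom poly_power)

lemma partial_x_pCons: "partial_x (pCons a f) = pCons (pderiv a) (partial_x f)"
  unfolding partial_x_def by (rule map_poly_pCons) simp

lemma partial_x_correct:
  "((\<lambda>x. bieval f x y) has_field_derivative bieval (partial_x f) x y) (at x)"
proof (induction f)
  case 0
  then show ?case by (simp add: bieval_def partial_x_def)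
next
  case (pCons a f)
  have "((\<lambda>x. poly a x + y * bieval f x y) has_field_derivative
          poly (pderiv a) x + y * bieval (partial_x f) x y) (at x)"
    by (intro DERIV_add DERIV_cmult pCons.IH poly_DERIV)
  then show ?case by (simp add: bieval_def partial_x_pCons)
qed

lemma partial_y_correct:
  "((\<lambda>y. bieval f x y) has_field_derivative bieval (partial_y f) x y) (at y)"
proof (induction f)
  case 0
  then show ?case by (simp add: bieval_def partial_y_def)
next
  case (pCons a f)
  have "((\<lambda>y. poly a x + y * bieval f x y) has_field_derivative
          (1 * bieval f x y + bieval (partial_y f) x y * y)) (at y)"
    by (auto intro!: derivative_eq_intros pCons.IH)
  then show ?case by (simp add: bieval_def partial_y_def pderiv_pCons algebra_simps)
qed

lemma bicoeff_layer: "bicoeff (layer l p) i j = (if i + j = l then bicoeff p i j else 0)"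
proof -
  have "bicoeff (layer l p) i j =
      (\<Sum>k\<le>l. if k = i then (if i + j = l then bicoeff p i j else 0) else 0)"
    unfolding layer_def bicoeff_def bimonom_def coeff_sum
    by (intro sum.cong) auto
  then show ?thesis by auto
qed

end

theory Submission
  imports Defs
begin

text \<open>
  The operator \<open>p(D)\<close> is triangular with respect to a monomial order. Let \<open>s\<close> be the order of
  vanishing of \<open>p\<close> at the origin, and let \<open>x\<^bsup>i\<^sub>0\<^esup> y\<^bsup>j\<^sub>0\<^esup>\<close> be the monomial of the lowest layer
  of \<open>p\<close> with the least exponent of \<open>y\<close>. Applied to \<open>x\<^bsup>a + i\<^sub>0\<^esup> y\<^bsup>b + j\<^sub>0\<^esup>\<close>, the term
  of \<open>p(D)\<close> belonging to this monomial yields a nonzero multiple of \<open>x\<^bsup>a\<^esup> y\<^bsup>b\<^esup>\<close>. A term from a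
  higher layer of \<open>p\<close> lowers the total degree further, and another term from the lowest layer
  gives the same total degree but, because it differentiates more often in \<open>y\<close>, a smaller
  exponent of \<open>y\<close>. So the image of \<open>x\<^bsup>a + i\<^sub>0\<^esup> y\<^bsup>b + j\<^sub>0\<^esup>\<close> has leading monomial \<open>x\<^bsup>a\<^esup> y\<^bsup>b\<^esup>\<close>
  when monomials are compared first by total degree and then by the exponent of \<open>y\<close>
  (lemma \<open>diff_op_shifted_monom\<close>).

  This order is well-founded, and the image of \<open>\<Pi>\<^bsub>m + s\<^esub>\<close> under \<open>p(D)\<close> is a linear space. By
  induction along the order this image contains every monomial of degree at most \<open>m\<close>, hence all
  of \<open>\<Pi>\<^bsub>m\<^esub>\<close> (lemma \<open>Pi_deg_subset_diff_op_image\<close>).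
\<close>

section \<open>Coefficients of bivariate polynomials\<close>

lemma bipoly_eq_iff: "p = q \<longleftrightarrow> (\<forall>i j. bicoeff p i j = bicoeff q i j)"
  by (auto simp: bicoeff_def poly_eq_iff)

lemma bicoeff_simps [simp]:
  "bicoeff 0 i j = 0"
  "bicoeff (p + q) i j = bicoeff p i j + bicoeff q i j"
  "bicoeff (p - q) i j = bicoeff p i j - bicoeff q i j"
  "bicoeff (smult [:c:] p) i j = c * bicoeff p i j"
  "bicoeff (bimonom c a b) i j = (if i = a \<and> j = b then c else 0)"
  by (auto simp: bicoeff_def bimonom_def)

lemma Pi_deg_iff: "f \<in> Pi_deg n \<longleftrightarrow> (\<forall>i j. n < i + j \<longrightarrow> bicoeff f i j = 0)"
  by (auto simp: Pi_deg_def not_le[symmetric])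

lemma Pi_deg_add: "f \<in> Pi_deg n \<Longrightarrow> g \<in> Pi_deg n \<Longrightarrow> f + g \<in> Pi_deg n"
  by (simp add: Pi_deg_iff)

lemma bicoeff_sum: "bicoeff (sum f A) i j = (\<Sum>k\<in>A. bicoeff (f k) i j)"
  by (simp add: bicoeff_def coeff_sum)

lemma bipoly_eq_sum_bimonom:
  "p = (\<Sum>j\<le>degree p. \<Sum>i\<le>degree (coeff p j). bimonom (bicoeff p i j) i j)"
proof -
  have "(\<Sum>i\<le>degree (coeff p j). bimonom (bicoeff p i j) i j) = monom (coeff p j) j" for j
  proof -
    have "(\<Sum>i\<le>degree (coeff p j). bimonom (bicoeff p i j) i j)
        = monom (\<Sum>i\<le>degree (coeff p j). monom (coeff (coeff p j) i) i) j"
      by (simp add: bimonom_def bicoeff_def monom_sum)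
    then show ?thesis
      by (simp add: poly_as_sum_of_monoms)
  qed
  then show ?thesis
    by (simp add: poly_as_sum_of_monoms)
qed

lemma bipoly_in_additive_set:
  assumes zero: "0 \<in> V"
    and add: "\<And>f g. f \<in> V \<Longrightarrow> g \<in> V \<Longrightarrow> f + g \<in> V"
    and monoms: "\<And>i j. bicoeff q i j \<noteq> 0 \<Longrightarrow> bimonom (bicoeff q i j) i j \<in> V"
  shows "q \<in> V"
proof -
  have sum_in: "(\<Sum>k\<in>A. f k) \<in> V" if "\<And>k. f k \<in> V" for f :: "nat \<Rightarrow> bipoly" and A
    using that by (induction A rule: infinite_finite_induct) (auto intro: zero add)
  have "bimonom (bicoeff q i j) i j \<in> V" for i j
    using monoms[of i j] zero by (cases "bicoeff q i j = 0") (auto simp: bimonom_def)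
  then show ?thesis
    by (subst bipoly_eq_sum_bimonom) (intro sum_in)
qed

section \<open>The operator in terms of coefficients\<close>

text \<open>
  Differentiation shifts the coefficients and multiplies them by rising factorials of positive
  integers. In characteristic zero these are nonzero, so a derivative kills a monomial only by
  shifting one of its exponents below zero.
\<close>

lemma bicoeff_partials:
  "bicoeff ((partial_x ^^ i) ((partial_y ^^ j) f)) u v
     = pochhammer (of_nat (Suc u)) i * pochhammer (of_nat (Suc v)) j * bicoeff f (u + i) (v + j)"
proof -
  have x: "coeff ((partial_x ^^ i) g) n = (pderiv ^^ i) (coeff g n)" for g n
    by (induction i) (simp_all add: partial_x_def coeff_map_poly)
  have y: "(partial_y ^^ j) f = (pderiv ^^ j) f"
    by (induction j) (simp_all add: partial_y_def)
  have "coeff (coeff ((pderiv ^^ j) f) v) n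
      = pochhammer (of_nat (Suc v)) j * coeff (coeff f (v + j)) n" for n
    unfolding coeff_higher_pderiv pochhammer_of_nat by (simp add: of_nat_poly)
  then show ?thesis
    by (simp add: bicoeff_def x y coeff_higher_pderiv del: of_nat_Suc)
qed

lemma bicoeff_diff_op:
  "bicoeff (diff_op p f) u v = (\<Sum>j\<le>degree p. \<Sum>i\<le>degree (coeff p j). bicoeff p i j *
     (pochhammer (of_nat (Suc u)) i * pochhammer (of_nat (Suc v)) j * bicoeff f (u + i) (v + j)))"
  by (simp add: diff_op_def bicoeff_sum bicoeff_partials del: of_nat_Suc)

lemma diff_op_0: "diff_op p 0 = 0"
  by (simp add: bipoly_eq_iff bicoeff_diff_op)

lemma diff_op_add: "diff_op p (f + g) = diff_op p f + diff_op p g"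
  by (simp add: bipoly_eq_iff bicoeff_diff_op distrib_left sum.distrib del: of_nat_Suc)

lemma diff_op_smult: "diff_op p (smult [:c:] f) = smult [:c:] (diff_op p f)"
  by (simp add: bipoly_eq_iff bicoeff_diff_op sum_distrib_left mult_ac del: of_nat_Suc)

section \<open>The leading monomial of an image\<close>

text \<open>
  The monomial \<open>x\<^bsup>i\<^sub>0\<^esup> y\<^bsup>j\<^sub>0\<^esup>\<close> that \<open>minimal\<close> describes plays the role of the leading term of
  \<open>p\<close>: it comes first in the lexicographic order by total degree and exponent of \<open>y\<close>. A monomial
  \<open>x\<^bsup>u\<^esup> y\<^bsup>v\<^esup>\<close> of the image arises from exactly one term \<open>x\<^bsup>i\<^esup> y\<^bsup>j\<^esup>\<close> of \<open>p\<close>, with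
  \<open>u + i = a + i\<^sub>0\<close> and \<open>v + j = b + j\<^sub>0\<close>, so a larger \<open>(i, j)\<close> means a smaller \<open>(u, v)\<close>.
\<close>

lemma diff_op_shifted_monom:
  fixes a b i0 j0 :: nat and p :: bipoly
  assumes nonzero: "bicoeff p i0 j0 \<noteq> 0"
    and minimal: "\<And>i j. bicoeff p i j \<noteq> 0 \<Longrightarrow>
      i0 + j0 < i + j \<or> (i0 + j0 = i + j \<and> j0 \<le> j)"
  defines "r \<equiv> diff_op p (bimonom 1 (a + i0) (b + j0))"
  shows "bicoeff r a b \<noteq> 0"
    and "\<And>u v. bicoeff r u v \<noteq> 0 \<Longrightarrow>
      (u, v) = (a, b) \<or> u + v < a + b \<or> (u + v = a + b \<and> v < b)"
proof -
  have pochhammer_nonzero: "pochhammer (of_nat (Suc n) :: complex) k \<noteq> 0" for n k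
    unfolding pochhammer_of_nat of_nat_eq_0_iff using pochhammer_pos[of "Suc n" k] by linarith
  have "bicoeff r a b = (\<Sum>j\<le>degree p. \<Sum>i\<le>degree (coeff p j).
      if i = i0 then if j = j0 then bicoeff p i0 j0 *
        (pochhammer (of_nat (Suc a)) i0 * pochhammer (of_nat (Suc b)) j0) else 0 else 0)"
    unfolding r_def bicoeff_diff_op by (intro sum.cong) auto
  also have "\<dots> = (\<Sum>j\<le>degree p. if j = j0 then if i0 \<le> degree (coeff p j0) then bicoeff p i0 j0 *
      (pochhammer (of_nat (Suc a)) i0 * pochhammer (of_nat (Suc b)) j0) else 0 else 0)"
    by (intro sum.cong) (auto simp del: of_nat_Suc)
  also have "\<dots> = bicoeff p i0 j0 *
      (pochhammer (of_nat (Suc a)) i0 * pochhammer (of_nat (Suc b)) j0)"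
  proof -
    have "i0 \<le> degree (coeff p j0)"
      using nonzero unfolding bicoeff_def by (rule le_degree)
    moreover have "j0 \<le> degree p"
      using nonzero by (intro le_degree) (auto simp: bicoeff_def)
    ultimately show ?thesis
      by (simp del: of_nat_Suc)
  qed
  finally show "bicoeff r a b \<noteq> 0"
    using nonzero pochhammer_nonzero by (simp del: of_nat_Suc)
next
  fix u v assume "bicoeff r u v \<noteq> 0"
  then obtain i j where "bicoeff p i j \<noteq> 0" "u + i = a + i0" "v + j = b + j0"
    unfolding r_def bicoeff_diff_op
    by (auto elim!: sum.not_neutral_contains_not_neutral split: if_splits)
  with minimal[of i j] show "(u, v) = (a, b) \<or> u + v < a + b \<or> (u + v = a + b \<and> v < b)"
    by auto
qed

section \<open>Surjectivity\<close>

text \<open>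
  Triangular elimination: the image of the shifted monomial is a nonzero multiple of
  \<open>x\<^bsup>a\<^esup> y\<^bsup>b\<^esup>\<close> plus monomials that are smaller in the order. By induction the latter lie in the
  image of \<open>p(D)\<close> already, and subtracting them leaves \<open>x\<^bsup>a\<^esup> y\<^bsup>b\<^esup>\<close>. The bound \<open>m\<close> stays fixed
  during the induction because a smaller monomial never has a larger total degree.
\<close>

lemma Pi_deg_subset_diff_op_image:
  assumes nonzero: "bicoeff p i0 j0 \<noteq> 0"
    and minimal: "\<And>i j. bicoeff p i j \<noteq> 0 \<Longrightarrow>
      i0 + j0 < i + j \<or> (i0 + j0 = i + j \<and> j0 \<le> j)"
  shows "Pi_deg m \<subseteq> diff_op p ` Pi_deg (m + (i0 + j0))"
proof -
  define V where "V = diff_op p ` Pi_deg (m + (i0 + j0))"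
  have V0: "0 \<in> V"
    unfolding V_def by (rule image_eqI[of _ _ 0]) (auto simp: diff_op_0 Pi_deg_def)
  have V_add: "f + g \<in> V" if "f \<in> V" "g \<in> V" for f g
  proof -
    from that obtain f' g' where "f' \<in> Pi_deg (m + (i0 + j0))" "g' \<in> Pi_deg (m + (i0 + j0))"
      and "f = diff_op p f'" "g = diff_op p g'"
      by (auto simp: V_def)
    moreover from this(1,2) have "f' + g' \<in> Pi_deg (m + (i0 + j0))"
      by (rule Pi_deg_add)
    ultimately show ?thesis
      by (auto simp: V_def diff_op_add[symmetric])
  qed
  have V_smult: "smult [:d:] f \<in> V" if "f \<in> V" for d f
    using that by (auto simp: V_def Pi_deg_def diff_op_smult[symmetric])
  let ?R = "inv_image (less_than <*lex*> less_than) (\<lambda>(a :: nat, b :: nat). (a + b, b))"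
  have "wf ?R"
    by auto
  then have monoms: "a + b \<le> m \<longrightarrow> (\<forall>c. bimonom c a b \<in> V)" for a b
  proof (induction "(a, b)" arbitrary: a b rule: wf_induct_rule)
    case (less a b)
    show ?case
    proof (intro impI allI)
      fix c assume ab: "a + b \<le> m"
      define r where "r = diff_op p (bimonom 1 (a + i0) (b + j0))"
      have lead: "bicoeff r a b \<noteq> 0"
        and lower: "\<And>u v. bicoeff r u v \<noteq> 0 \<Longrightarrow>
          (u, v) = (a, b) \<or> u + v < a + b \<or> (u + v = a + b \<and> v < b)"
        unfolding r_def using diff_op_shifted_monom[OF nonzero minimal] by blast+
      have "bimonom 1 (a + i0) (b + j0) \<in> Pi_deg (m + (i0 + j0))"
        using ab by (auto simp: Pi_deg_def)
      then have "r \<in> V"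
        by (auto simp: V_def r_def)
      \<comment> \<open>The lower terms of \<open>r\<close> with opposite sign, so that \<open>r + t\<close> is the leading term alone.\<close>
      define t where "t = bimonom (bicoeff r a b) a b - r"
      have "t \<in> V"
      proof (rule bipoly_in_additive_set[OF V0 V_add])
        fix u v assume nz: "bicoeff t u v \<noteq> 0"
        then have smaller: "u + v < a + b \<or> (u + v = a + b \<and> v < b)"
          using lower[of u v] by (auto simp: t_def split: if_splits)
        then have "((u, v), (a, b)) \<in> ?R" "u + v \<le> m"
          using ab by auto
        then show "bimonom (bicoeff t u v) u v \<in> V"
          using less by blast
      qed
      with \<open>r \<in> V\<close> have "smult [:c / bicoeff r a b:] (r + t) \<in> V"
        by (intro V_smult V_add)
      also have "smult [:c / bicoeff r a b:] (r + t) = bimonom c a b"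
        using lead by (auto simp: bipoly_eq_iff t_def)
      finally show "bimonom c a b \<in> V" .
    qed
  qed
  have "q \<in> V" if "q \<in> Pi_deg m" for q
  proof (rule bipoly_in_additive_set[OF V0 V_add])
    fix i j assume "bicoeff q i j \<noteq> 0"
    with that monoms show "bimonom (bicoeff q i j) i j \<in> V"
      by (simp add: Pi_deg_def)
  qed
  then show ?thesis
    by (auto simp: V_def)
qed

lemma layer_eq_0_iff: "layer l p = 0 \<longleftrightarrow> (\<forall>i j. i + j = l \<longrightarrow> bicoeff p i j = 0)"
  by (auto simp: bipoly_eq_iff bicoeff_layer)

theorem theorem2p1:
  fixes m s :: nat and p q :: bipoly
  assumes "q \<in> Pi_deg m"
    and "s_fold_zero_at_origin s p"
  shows "\<exists>f \<in> Pi_deg (m + s). diff_op p f = q"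
proof -
  have vanish: "bicoeff p i j = 0" if "i + j < s" for i j
    using assms(2) that by (auto simp: s_fold_zero_at_origin_def layer_eq_0_iff)
  define j0 where "j0 = (LEAST j. \<exists>i. i + j = s \<and> bicoeff p i j \<noteq> 0)"
  have "\<exists>j i. i + j = s \<and> bicoeff p i j \<noteq> 0"
    using assms(2) by (auto simp: s_fold_zero_at_origin_def layer_eq_0_iff)
  then have "\<exists>i. i + j0 = s \<and> bicoeff p i j0 \<noteq> 0"
    unfolding j0_def by (rule LeastI_ex)
  then obtain i0 where s: "s = i0 + j0" and nonzero: "bicoeff p i0 j0 \<noteq> 0"
    by auto
  have minimal: "i0 + j0 < i + j \<or> (i0 + j0 = i + j \<and> j0 \<le> j)" if "bicoeff p i j \<noteq> 0" for i j
  proof (cases "i + j = s")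
    case True
    then have "j0 \<le> j"
      unfolding j0_def using that by (intro Least_le) auto
    with True s show ?thesis
      by simp
  next
    case False
    with vanish[of i j] that s show ?thesis
      by (meson linorder_neqE_nat)
  qed
  show ?thesis
    using Pi_deg_subset_diff_op_image[OF nonzero minimal] assms(1) unfolding s by blast
qed

end
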